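(* Let $n\ge 1$. The basis $\mathbf N=\{\nu_\pi\}_{\pi\in S_n}$ of the Hecke algebra $\mathscr H_n(z)$ consisting of negative permutation braids is orthonormal with respect to the left inner product; that is, for all $\pi,\kappa\in S_n$, $\langle \nu_\pi,\nu_\kappa\rangle_L = 1$ if $\pi=\kappa$, and $\langle \nu_\pi,\nu_\kappa\rangle_L=0$ if $\pi\neq\kappa$.
   Context: $B_n$ is Artin's braid group with generators $\sigma_1,\dots,\sigma_{n-1}$ and relations $\sigma_i\sigma_j=\sigma_j\sigma_i$ for $|i-j|\ge 2$, $\sigma_i\sigma_{i+1}\sigma_i=\sigma_{i+1}\sigma_i\sigma_{i+1}$. The Hecke algebra $\mathscr H_n(z)$ is the $\mathbf Z[z]$-algebra generated by $\sigma_1,\dots,\sigma_{n-1}$ (invertible) subject to these relations and $\sigma_i-\sigma_i^{-1}=z$ for all $i$. It is a free $\mathbf Z[z]$-module of rank $n!$. A braid $\beta\in B_n$ and its image in $\mathscr H_n(z)$ are denoted by the same symbol. Ocneanu's trace $\mathrm{Tr}$ is the family of $\mathbf Z[z]$-linear maps $\mathscr H_n(z)\to\mathbf Z[z,T]$, $n\ge1$, compatible with the inclusions $\mathscr H_n(z)\subset\mathscr H_{n+1}(z)$ and characterized by $\mathrm{Tr}(1)=1$, $\mathrm{Tr}(ab)=\mathrm{Tr}(ba)$, and $\mathrm{Tr}(x\sigma_n)=T\,\mathrm{Tr}(x)$ for $x\in\mathscr H_n(z)$. The framed Homfly polynomial of $\beta\in B_n$ is $$H_\beta(v,z)=\left(\frac{v^{-1}-v}{z}\right)^{n-1}\cdot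 \mathrm{Tr}(\beta)\Big|_{T=\frac{z}{1-v^2}},$$ a Laurent polynomial in $v$ and $z$. Put $L_\beta(z)=z^{n-1}\cdot(\text{the coefficient of }v^{1-n}\text{ in }H_\beta(v,z))\in\mathbf Z[z]$. For $\beta\in B_n$, $\beta^*$ is the braid obtained by writing the letters of a braid word representing $\beta$ in reverse order (letters $\sigma_i^{\pm1}$ keep their exponents). The left inner product of $\alpha,\beta\in B_n$ is $\langle\alpha,\beta\rangle_L=L_{\alpha\beta^*}(z)$; it extends to a $\mathbf Z[z]$-bilinear form on $\mathscr H_n(z)$ with values in $\mathbf Z[z]$. For $\pi\in S_n$, with a reduced expression $\pi=s_{i_1}\cdots s_{i_k}$ in the adjacent transpositions $s_i=(i\ i+1)$, the negative permutation braid of $\pi$ is $\nu_\pi=\sigma_{i_1}^{-1}\cdots\sigma_{i_k}^{-1}\in B_n$ (independent of the reduced expression). The set $\mathbf N=\{\nu_\pi\}_{\pi\in S_n}$ is a $\mathbf Z[z]$-basis of $\mathscr H_n(z)$. *)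

theory Defs
  imports
    "HOL-Algebra.QuotRing"
    "HOL-Library.Poly_Mapping"
    "HOL-Computational_Algebra.Computational_Algebra"
    "HOL-Combinatorics.Permutations"
begin

section \<open>Braid words and the braid group\<close>

datatype letter = Pos (strand: nat) | Neg (strand: nat)

text \<open>
  \<open>Pos i\<close> and \<open>Neg i\<close> stand for \<open>\<sigma>\<^sub>i\<close> and its inverse.  Words are wrapped in a type of
  their own so that concatenation can serve as the monoid operation of class
  \<^class>\<open>monoid_add\<close>; finitely supported functions \<open>braid_word \<Rightarrow>\<^sub>0 R\<close> with the convolution
  product of \<^theory>\<open>HOL-Library.Poly_Mapping\<close> then form the free associative \<open>R\<close>-algebra.
\<close>

datatype braid_word = Word (letters: "letter list")

instantiation braid_word :: monoid_add
begin

definition zero_braid_word :: braid_word where "0 = Word []"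

definition plus_braid_word :: "braid_word \<Rightarrow> braid_word \<Rightarrow> braid_word" where
  "u + v = Word (letters u @ letters v)"

instance by standard (simp_all add: zero_braid_word_def plus_braid_word_def)

end

definition words :: "nat \<Rightarrow> braid_word set" where
  "words n = {w. strand ` set (letters w) \<subseteq> {1..<n}}"

definition word_rev :: "braid_word \<Rightarrow> braid_word" where
  "word_rev w = Word (rev (letters w))"

definition braid_relators :: "nat \<Rightarrow> (braid_word \<times> braid_word) set" where
  "braid_relators n =
     {(Word [Pos i, Neg i], 0) | i. i \<in> {1..<n}} \<union>
     {(Word [Neg i, Pos i], 0) | i. i \<in> {1..<n}} \<union>
     {(Word [Pos i, Pos j], Word [Pos j, Pos i]) | i j.
        i \<in> {1..<n} \<and> j \<in> {1..<n} \<and> \<bar>int i - int j\<bar> \<ge> 2} \<union>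
     {(Word [Pos i, Pos (Suc i), Pos i], Word [Pos (Suc i), Pos i, Pos (Suc i)]) | i.
        i \<in> {1..<n} \<and> Suc i \<in> {1..<n}}"

inductive_set braid_eq :: "nat \<Rightarrow> (braid_word \<times> braid_word) set" for n :: nat where
  relator: "(u, v) \<in> braid_relators n \<Longrightarrow> (u, v) \<in> braid_eq n"
| refl: "w \<in> words n \<Longrightarrow> (w, w) \<in> braid_eq n"
| sym: "(u, v) \<in> braid_eq n \<Longrightarrow> (v, u) \<in> braid_eq n"
| trans: "(u, v) \<in> braid_eq n \<Longrightarrow> (v, w) \<in> braid_eq n \<Longrightarrow> (u, w) \<in> braid_eq n"
| cong: "(u, v) \<in> braid_eq n \<Longrightarrow> a \<in> words n \<Longrightarrow> b \<in> words n \<Longrightarrow> (a + u + b, a + v + b) \<in> braid_eq n"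

text \<open>
  Operations on classes are lifted by taking the union over all representatives: the results
  agree for all representatives, so the union is again a single class.
\<close>

definition braid_group :: "nat \<Rightarrow> braid_word set monoid" where
  "braid_group n =
     \<lparr>carrier = words n // braid_eq n,
      monoid.mult = (\<lambda>\<alpha> \<beta>. \<Union>u\<in>\<alpha>. \<Union>w\<in>\<beta>. braid_eq n `` {u + w}),
      one = braid_eq n `` {0}\<rparr>"

definition braid_star :: "nat \<Rightarrow> braid_word set \<Rightarrow> braid_word set" where
  "braid_star n \<beta> = (\<Union>w\<in>\<beta>. braid_eq n `` {word_rev w})"

section \<open>Permutations and negative permutation braids\<close>

definition perm_of_word :: "nat list \<Rightarrow> nat \<Rightarrow> nat" where
  "perm_of_word ks = foldr (\<lambda>i p. transpose i (Suc i) \<circ> p) ks id"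

definition reduced_expression :: "nat \<Rightarrow> (nat \<Rightarrow> nat) \<Rightarrow> nat list \<Rightarrow> bool" where
  "reduced_expression n \<pi> ks \<longleftrightarrow>
     set ks \<subseteq> {1..<n} \<and> perm_of_word ks = \<pi> \<and>
     (\<forall>js. set js \<subseteq> {1..<n} \<and> perm_of_word js = \<pi> \<longrightarrow> length ks \<le> length js)"

text \<open>The braid below does not depend on the chosen reduced expression (Matsumoto's theorem).\<close>

definition neg_perm_braid :: "nat \<Rightarrow> (nat \<Rightarrow> nat) \<Rightarrow> braid_word set" where
  "neg_perm_braid n \<pi> =
     braid_eq n `` {Word (map Neg (SOME ks. reduced_expression n \<pi> ks))}"

section \<open>The Hecke algebra\<close>

text \<open>\<^typ>\<open>int poly\<close> is \<open>\<int>[z]\<close>, with \<open>z = [:0, 1:]\<close>.\<close>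

type_synonym free_elem = "braid_word \<Rightarrow>\<^sub>0 int poly"

definition free_algebra :: "nat \<Rightarrow> free_elem ring" where
  "free_algebra n =
     \<lparr>carrier = {f. Poly_Mapping.keys f \<subseteq> words n}, monoid.mult = (*), one = 1, zero = 0, add = (+)\<rparr>"

definition of_word :: "braid_word \<Rightarrow> free_elem" where
  "of_word w = Poly_Mapping.single w 1"

definition scalar :: "int poly \<Rightarrow> free_elem" where
  "scalar c = Poly_Mapping.single 0 c"

definition hecke_relators :: "nat \<Rightarrow> free_elem set" where
  "hecke_relators n =
     {of_word u - of_word v | u v. (u, v) \<in> braid_relators n} \<union>
     {of_word (Word [Pos i]) - of_word (Word [Neg i]) - scalar [:0, 1:] | i. i \<in> {1..<n}}"

definition hecke_ideal :: "nat \<Rightarrow> free_elem set" where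
  "hecke_ideal n = Idl\<^bsub>free_algebra n\<^esub> (hecke_relators n)"

definition hecke_algebra :: "nat \<Rightarrow> free_elem set ring" where
  "hecke_algebra n = free_algebra n Quot hecke_ideal n"

definition hecke_class :: "nat \<Rightarrow> free_elem \<Rightarrow> free_elem set" where
  "hecke_class n f = hecke_ideal n +>\<^bsub>free_algebra n\<^esub> f"

definition hecke_smult :: "nat \<Rightarrow> int poly \<Rightarrow> free_elem set \<Rightarrow> free_elem set" where
  "hecke_smult n c x = hecke_class n (scalar c) \<otimes>\<^bsub>hecke_algebra n\<^esub> x"

definition hecke_sigma :: "nat \<Rightarrow> nat \<Rightarrow> free_elem set" where
  "hecke_sigma n i = hecke_class n (of_word (Word [Pos i]))"

definition hecke_inclusion :: "nat \<Rightarrow> free_elem set \<Rightarrow> free_elem set" where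
  "hecke_inclusion n x = (\<Union>f\<in>x. hecke_class (Suc n) f)"

definition hecke_of_braid :: "nat \<Rightarrow> braid_word set \<Rightarrow> free_elem set" where
  "hecke_of_braid n \<beta> = (\<Union>w\<in>\<beta>. hecke_class n (of_word w))"

section \<open>Ocneanu's trace, the framed Homfly polynomial and the left inner product\<close>

text \<open>\<^typ>\<open>int poly poly\<close> is \<open>\<int>[z,T]\<close>, with \<open>T = [:0, 1:]\<close> the outer variable.\<close>

definition ocneanu_trace :: "(nat \<Rightarrow> free_elem set \<Rightarrow> int poly poly) \<Rightarrow> bool" where
  "ocneanu_trace Tr \<longleftrightarrow> (\<forall>n\<ge>1.
     (\<forall>x\<in>carrier (hecke_algebra n). \<forall>y\<in>carrier (hecke_algebra n).
        Tr n (x \<oplus>\<^bsub>hecke_algebra n\<^esub> y) = Tr n x + Tr n y) \<and>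
     (\<forall>c. \<forall>x\<in>carrier (hecke_algebra n). Tr n (hecke_smult n c x) = smult c (Tr n x)) \<and>
     (\<forall>x\<in>carrier (hecke_algebra n). Tr (Suc n) (hecke_inclusion n x) = Tr n x) \<and>
     Tr n \<one>\<^bsub>hecke_algebra n\<^esub> = 1 \<and>
     (\<forall>x\<in>carrier (hecke_algebra n). \<forall>y\<in>carrier (hecke_algebra n).
        Tr n (x \<otimes>\<^bsub>hecke_algebra n\<^esub> y) = Tr n (y \<otimes>\<^bsub>hecke_algebra n\<^esub> x)) \<and>
     (\<forall>x\<in>carrier (hecke_algebra n).
        Tr (Suc n) (hecke_inclusion n x \<otimes>\<^bsub>hecke_algebra (Suc n)\<^esub> hecke_sigma (Suc n) n)
          = [:0, 1:] * Tr n x))"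

text \<open>
  Laurent polynomials in \<open>v\<close> and \<open>z\<close>, and rational functions such as \<open>z / (1 - v\<^sup>2)\<close>, are
  read in the field \<open>\<rat>(z)((v))\<close> of formal Laurent series in \<open>v = fls_X\<close> over
  \<open>\<rat>(z) = Frac \<int>[z]\<close>.  For Laurent polynomials
  the coefficient of a power of \<open>v\<close> is the same in both readings.
\<close>

definition zvar :: "int poly fract" where
  "zvar = to_fract [:0, 1:]"

definition framed_homfly ::
  "(nat \<Rightarrow> free_elem set \<Rightarrow> int poly poly) \<Rightarrow> nat \<Rightarrow> braid_word set \<Rightarrow> int poly fract fls" where
  "framed_homfly Tr n \<beta> =
     ((inverse fls_X - fls_X) / fls_const zvar) ^ (n - 1) *
     poly (map_poly (\<lambda>c. fls_const (to_fract c)) (Tr n (hecke_of_braid n \<beta>)))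
       (fls_const zvar / (1 - fls_X ^ 2))"

definition left_poly ::
  "(nat \<Rightarrow> free_elem set \<Rightarrow> int poly poly) \<Rightarrow> nat \<Rightarrow> braid_word set \<Rightarrow> int poly fract" where
  "left_poly Tr n \<beta> = zvar ^ (n - 1) * fls_nth (framed_homfly Tr n \<beta>) (1 - int n)"

definition left_inner ::
  "(nat \<Rightarrow> free_elem set \<Rightarrow> int poly poly) \<Rightarrow> nat \<Rightarrow> braid_word set \<Rightarrow> braid_word set \<Rightarrow> int poly fract" where
  "left_inner Tr n \<alpha> \<beta> = left_poly Tr n (\<alpha> \<otimes>\<^bsub>braid_group n\<^esub> braid_star n \<beta>)"

end

theory Submission
  imports Defs
begin

text \<open>
  Up to the factor \<open>v\<^sup>1\<^sup>-\<^sup>n\<close>, \<open>H\<^sub>\<beta>\<close> is a power series in \<open>v\<close>, so its extreme coefficient is obtained by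
  setting \<open>v = 0\<close>: the polynomial \<open>L\<^sub>\<beta>\<close> is \<open>Tr(\<beta>)\<close> at \<open>T = z\<close>.  There the skein relation turns
  \<open>Tr(x \<sigma>\<^sub>n) = T Tr(x)\<close> into \<open>Tr(x \<sigma>\<^sub>n\<^sup>-\<^sup>1) = 0\<close>.  Every permutation other than the identity has a
  reduced expression in which the largest letter occurs exactly once, so this trace vanishes on
  \<open>\<nu>\<^sub>\<pi>\<close> for \<open>\<pi> \<noteq> id\<close>.  With \<open>\<tau>\<^sub>i = \<sigma>\<^sub>i\<^sup>-\<^sup>1\<close> one has \<open>\<tau>\<^sub>i\<^sup>2 = 1 - z \<tau>\<^sub>i\<close>, hence \<open>\<nu>\<^sub>\<pi> \<tau>\<^sub>i\<close> is
  \<open>\<nu>\<close> of \<open>\<pi> s\<^sub>i\<close> if \<open>\<pi>(i) < \<pi>(i + 1)\<close>, and that minus \<open>z \<nu>\<^sub>\<pi>\<close> otherwise.  Moving the letters of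
  \<open>\<nu>\<^sub>\<kappa>\<^sup>*\<close> one by one into \<open>\<nu>\<^sub>\<pi>\<close> gives orthonormality by induction on the length of \<open>\<kappa>\<close>; the
  correction term vanishes because \<open>\<pi>\<close> then descends at \<open>i\<close> while the shortened \<open>\<kappa>\<close> ascends.
\<close>

section \<open>Normal forms of permutations\<close>

lemma perm_of_word_Nil [simp]: "perm_of_word [] = id"
  by (simp add: perm_of_word_def)

lemma perm_of_word_Cons [simp]: "perm_of_word (i # ks) = transpose i (Suc i) \<circ> perm_of_word ks"
  by (simp add: perm_of_word_def)

lemma perm_of_word_append [simp]: "perm_of_word (us @ vs) = perm_of_word us \<circ> perm_of_word vs"
  by (induction us) (simp_all add: comp_assoc)

lemma perm_of_word_snoc: "perm_of_word (ks @ [i]) = perm_of_word ks \<circ> transpose i (Suc i)"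
  by simp

lemma perm_of_word_permutes:
  assumes "set ks \<subseteq> {1..<n}"
  shows "perm_of_word ks permutes {1..n}"
  using assms by (induction ks) (auto simp: permutes_id intro!: permutes_compose permutes_swap_id)

text \<open>A run of consecutive letters spells a cycle. This closed form turns the later identities
  between cycles and transpositions into pointwise case checks.\<close>

lemma perm_of_word_upt:
  assumes "k \<le> m"
  shows "perm_of_word [k..<m] j = (if j = m then k else if k \<le> j \<and> j < m then Suc j else j)"
  using assms
proof (induction m arbitrary: j)
  case (Suc m)
  show ?case
  proof (cases "k = Suc m")
    case False
    with Suc show ?thesis by (auto simp: transpose_def)
  qed simp
qed simp

lemma perm_of_word_upt_rev: "perm_of_word [k..<m] \<circ> perm_of_word (rev [k..<m]) = id"
proof (induction m)
  case (Suc m)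
  show ?case
  proof (cases "k \<le> m")
    case True
    then have "perm_of_word [k..<Suc m] \<circ> perm_of_word (rev [k..<Suc m]) =
        perm_of_word [k..<m] \<circ> (transpose m (Suc m) \<circ> transpose m (Suc m)) \<circ> perm_of_word (rev [k..<m])"
      by (simp add: comp_assoc del: transpose_comp_involutory)
    then show ?thesis using Suc by simp
  next
    case False
    then show ?thesis by simp
  qed
qed simp

section \<open>Words modulo the far commutation and braid relations\<close>

inductive artin_eq :: "nat \<Rightarrow> nat list \<Rightarrow> nat list \<Rightarrow> bool" for n where
  refl: "set u \<subseteq> {1..<n} \<Longrightarrow> artin_eq n u u"
| sym: "artin_eq n u v \<Longrightarrow> artin_eq n v u"
| trans: "artin_eq n u v \<Longrightarrow> artin_eq n v w \<Longrightarrow> artin_eq n u w"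
| append: "artin_eq n u v \<Longrightarrow> set a \<subseteq> {1..<n} \<Longrightarrow> set b \<subseteq> {1..<n} \<Longrightarrow> artin_eq n (a @ u @ b) (a @ v @ b)"
| commute: "i \<in> {1..<n} \<Longrightarrow> j \<in> {1..<n} \<Longrightarrow> \<bar>int i - int j\<bar> \<ge> 2 \<Longrightarrow> artin_eq n [i, j] [j, i]"
| braid: "i \<in> {1..<n} \<Longrightarrow> Suc i \<in> {1..<n} \<Longrightarrow> artin_eq n [i, Suc i, i] [Suc i, i, Suc i]"

text \<open>Both relations are homogeneous, and \<open>artin_eq\<close> has no rule for cancelling a
  letter. Lengths of words can therefore be compared through it.\<close>

lemma artin_eq_length: "artin_eq n u v \<Longrightarrow> length u = length v"
  by (induction rule: artin_eq.induct) auto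

lemma artin_eq_mono: "artin_eq n u v \<Longrightarrow> n \<le> m \<Longrightarrow> artin_eq m u v"
proof (induction rule: artin_eq.induct)
  case (append u v a b)
  then show ?case by (intro artin_eq.append) auto
next
  case (refl u)
  then show ?case by (intro artin_eq.refl) auto
qed (auto intro: artin_eq.intros)

lemma artin_eq_commute_word:
  assumes "set u \<subseteq> {1..<n}" "i \<in> {1..<n}" "\<And>j. j \<in> set u \<Longrightarrow> \<bar>int i - int j\<bar> \<ge> 2"
  shows "artin_eq n (u @ [i]) (i # u)"
  using assms
proof (induction u)
  case Nil
  then show ?case by (auto intro: artin_eq.refl)
next
  case (Cons j u)
  have "artin_eq n (u @ [i]) (i # u)" using Cons by simp
  then have "artin_eq n ([j] @ (u @ [i]) @ []) ([j] @ (i # u) @ [])"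
    by (rule artin_eq.append) (use Cons in auto)
  moreover have "artin_eq n ([] @ [j, i] @ u) ([] @ [i, j] @ u)"
  proof (rule artin_eq.append)
    show "artin_eq n [j, i] [i, j]"
      using Cons.prems(1,2) Cons.prems(3)[of j] by (intro artin_eq.sym[OF artin_eq.commute]) auto
  qed (use Cons in auto)
  ultimately show ?case by (auto intro: artin_eq.trans)
qed

text \<open>In a descending run the letter \<open>i\<close> first commutes past everything below
  \<open>i - 1\<close>, then meets \<open>i, i - 1\<close> and takes part in one braid relation. It
  leaves as \<open>i - 1\<close>, which commutes past everything above \<open>i\<close>.\<close>

lemma artin_eq_slide:
  assumes "k < i" "i < m" "1 \<le> k" "m \<le> n"
  shows "artin_eq n (rev [k..<m] @ [i]) ((i - 1) # rev [k..<m])"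
proof -
  obtain j where j: "i = Suc j" using assms(1) by (cases i) auto
  have split: "rev [k..<m] = rev [Suc i..<m] @ [i, j] @ rev [k..<j]"
  proof -
    have "[k..<m] = [k..<j] @ [j..<m]"
      using assms j upt_add_eq_append[of k j "m - j"] by simp
    moreover have "[j..<m] = j # i # [Suc i..<m]"
      using assms j by (simp add: upt_conv_Cons)
    ultimately show ?thesis by simp
  qed
  let ?A = "rev [Suc i..<m]" and ?B = "rev [k..<j]"
  have "artin_eq n ((?A @ [i, j]) @ (?B @ [i]) @ []) ((?A @ [i, j]) @ (i # ?B) @ [])"
    by (rule artin_eq.append[OF artin_eq_commute_word]) (use assms j in auto)
  moreover have "artin_eq n (?A @ [i, j, i] @ ?B) (?A @ [j, i, j] @ ?B)"
  proof (rule artin_eq.append)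
    show "artin_eq n [i, j, i] [j, i, j]"
      unfolding j by (intro artin_eq.sym[OF artin_eq.braid]) (use assms j in auto)
  qed (use assms j in auto)
  moreover have "artin_eq n ([] @ (?A @ [j]) @ ([i, j] @ ?B)) ([] @ (j # ?A) @ ([i, j] @ ?B))"
    by (rule artin_eq.append[OF artin_eq_commute_word]) (use assms j in auto)
  ultimately show ?thesis unfolding split using j by (auto intro: artin_eq.trans)
qed

section \<open>Normal words and multiplication by an adjacent transposition\<close>

declare upt_Suc [simp del]

text \<open>
  The letters \<open>n, \<dots>, k\<close> carry the largest value \<open>Suc n\<close> from the last position to its
  position \<open>k\<close> in \<open>w\<close>; undoing them leaves a permutation of \<open>{1..n}\<close>.  The Hilbert inverse is
  written \<open>inv_into UNIV\<close> because \<open>inv\<close> is the inverse of HOL-Algebra here.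
\<close>

fun normal_word :: "nat \<Rightarrow> (nat \<Rightarrow> nat) \<Rightarrow> nat list" where
  "normal_word 0 w = []"
| "normal_word (Suc n) w =
     (let k = inv_into UNIV w (Suc n) in normal_word n (w \<circ> perm_of_word [k..<Suc n]) @ rev [k..<Suc n])"

lemma top_position:
  assumes "w permutes {1..Suc n}"
  shows "1 \<le> inv_into UNIV w (Suc n)" "inv_into UNIV w (Suc n) \<le> Suc n" "w (inv_into UNIV w (Suc n)) = Suc n"
  using permutes_in_image[OF permutes_inv[OF assms], of "Suc n"] permutes_inverses(1)[OF assms]
  by auto

text \<open>The cycle sends \<open>Suc n\<close> to the position of the largest value, so the
  composite fixes \<open>Suc n\<close>.\<close>

lemma delete_top_permutes:
  assumes w: "w permutes {1..Suc n}"
  shows "w \<circ> perm_of_word [inv_into UNIV w (Suc n)..<Suc n] permutes {1..n}"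
proof (rule permutes_superset)
  let ?k = "inv_into UNIV w (Suc n)"
  show "w \<circ> perm_of_word [?k..<Suc n] permutes {1..Suc n}"
    using top_position[OF w]
    by (intro permutes_compose[OF _ w] perm_of_word_permutes) auto
  show "\<And>x. x \<in> {1..Suc n} - {1..n} \<Longrightarrow> (w \<circ> perm_of_word [?k..<Suc n]) x = x"
    using top_position[OF w] by (auto simp: perm_of_word_upt le_Suc_eq)
qed

lemma normal_word_set:
  assumes "w permutes {1..n}"
  shows "set (normal_word n w) \<subseteq> {1..<n}"
  using assms
proof (induction n arbitrary: w)
  case (Suc n)
  let ?k = "inv_into UNIV w (Suc n)"
  have "set (normal_word n (w \<circ> perm_of_word [?k..<Suc n])) \<subseteq> {1..<n}"
    by (rule Suc.IH[OF delete_top_permutes[OF Suc.prems]])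
  moreover have "{1..<n} \<subseteq> {1..<Suc n}" "set (rev [?k..<Suc n]) \<subseteq> {1..<Suc n}"
    using top_position[OF Suc.prems] by auto
  ultimately show ?case by (simp only: normal_word.simps Let_def set_append) blast
qed simp

lemma perm_of_normal_word:
  assumes "w permutes {1..n}"
  shows "perm_of_word (normal_word n w) = w"
  using assms
proof (induction n arbitrary: w)
  case (Suc n)
  let ?k = "inv_into UNIV w (Suc n)"
  have "perm_of_word (normal_word n (w \<circ> perm_of_word [?k..<Suc n])) = w \<circ> perm_of_word [?k..<Suc n]"
    by (rule Suc.IH[OF delete_top_permutes[OF Suc.prems]])
  then show ?case
    by (simp add: Let_def comp_assoc perm_of_word_upt_rev)
qed simp

text \<open>The position \<open>k\<close> of the largest value decides how \<open>i\<close> meets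
  the final run. If \<open>k = Suc i\<close>, the run grows by one letter; if \<open>k\<close> lies
  further right, \<open>i\<close> commutes past the run; if \<open>k\<close> lies left of
  \<open>i\<close>, the letter slides through and becomes \<open>i - 1\<close>. In the last two
  cases the recursion absorbs the letter that comes out.\<close>

lemma normal_word_ascent:
  assumes "w permutes {1..n}" "i \<in> {1..<n}" "w i < w (Suc i)"
  shows "artin_eq n (normal_word n w @ [i]) (normal_word n (w \<circ> transpose i (Suc i)))"
  using assms
proof (induction n arbitrary: w i)
  case (Suc n)
  let ?s = "transpose i (Suc i)" and ?k = "inv_into UNIV w (Suc n)"
  let ?c = "perm_of_word [?k..<Suc n]"
  have s: "?s permutes {1..Suc n}" using Suc.prems by (intro permutes_swap_id) auto
  note k = top_position[OF Suc.prems(1)]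
  have inv': "inv_into UNIV (w \<circ> ?s) (Suc n) = ?s ?k"
    by (rule inv_f_eq) (use Suc.prems s k in \<open>auto intro: permutes_inj permutes_compose\<close>)
  have bound: "w j \<le> Suc n" if "j \<in> {1..Suc n}" for j
    using permutes_in_image[OF Suc.prems(1)] that by force
  \<comment> \<open>The largest value stands at \<open>k\<close>, and no ascent can start
    there.\<close>
  have "i \<noteq> ?k" using Suc.prems bound[of "Suc i"] k by force
  note a = delete_top_permutes[OF Suc.prems(1)]
  let ?a = "normal_word n (w \<circ> ?c)"
  have a_set: "set ?a \<subseteq> {1..<n}" by (rule normal_word_set[OF a])
  have c_apply: "?c j = (if j = Suc n then ?k else if ?k \<le> j \<and> j < Suc n then Suc j else j)" for j
    using k(2) by (rule perm_of_word_upt)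
  consider "Suc i = ?k" | "Suc i < ?k" | "?k < i" using \<open>i \<noteq> ?k\<close> by linarith
  then show ?case
  proof cases
    case 1
    have "w \<circ> ?s \<circ> perm_of_word [i..<Suc n] = w \<circ> ?c"
    proof -
      have "perm_of_word [i..<Suc n] = ?s \<circ> ?c"
        using 1 k by (simp add: upt_conv_Cons)
      then show ?thesis by (simp add: comp_assoc[symmetric]) (simp add: comp_assoc)
    qed
    moreover have "rev [i..<Suc n] = rev [?k..<Suc n] @ [i]"
      using 1 k by (simp add: upt_conv_Cons)
    moreover have "inv_into UNIV (w \<circ> ?s) (Suc n) = i" using inv' 1 by simp
    ultimately have "normal_word (Suc n) w @ [i] = normal_word (Suc n) (w \<circ> ?s)"
      by (simp add: Let_def)
    moreover have "set (normal_word (Suc n) w @ [i]) \<subseteq> {1..<Suc n}"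
      using normal_word_set[OF Suc.prems(1)] Suc.prems(2) by simp
    ultimately show ?thesis by (metis artin_eq.refl)
  next
    case 2
    have cs: "?s \<circ> ?c = ?c \<circ> ?s"
      unfolding fun_eq_iff c_apply comp_apply transpose_def using 2 k by auto
    then have comm: "w \<circ> ?s \<circ> ?c = w \<circ> ?c \<circ> ?s" by (simp only: comp_assoc)
    have "(w \<circ> ?c) i < (w \<circ> ?c) (Suc i)"
      using 2 k Suc.prems by (simp add: c_apply)
    then have IH: "artin_eq n (?a @ [i]) (normal_word n (w \<circ> ?c \<circ> ?s))"
      using 2 k Suc.prems(2) by (intro Suc.IH[OF a]) auto
    have "artin_eq (Suc n) ([] @ (?a @ [i]) @ rev [?k..<Suc n])
        ([] @ normal_word n (w \<circ> ?c \<circ> ?s) @ rev [?k..<Suc n])"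
      by (rule artin_eq.append[OF artin_eq_mono[OF IH]]) (use k in auto)
    then have "artin_eq (Suc n) (?a @ i # rev [?k..<Suc n]) (normal_word (Suc n) (w \<circ> ?s))"
      using inv' 2 comm by (simp add: Let_def transpose_def)
    moreover have "artin_eq (Suc n) (?a @ (rev [?k..<Suc n] @ [i]) @ []) (?a @ (i # rev [?k..<Suc n]) @ [])"
      by (rule artin_eq.append[OF artin_eq_commute_word]) (use 2 k a_set Suc.prems(2) in auto)
    ultimately have "artin_eq (Suc n) (?a @ rev [?k..<Suc n] @ [i]) (normal_word (Suc n) (w \<circ> ?s))"
      unfolding append_Nil2 by (rule artin_eq.trans[rotated])
    then show ?thesis by (simp only: normal_word.simps Let_def append_assoc)
  next
    case 3
    let ?t = "transpose (i - 1) (Suc (i - 1))"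
    obtain m where m: "i = Suc m" using 3 by (cases i) auto
    \<comment> \<open>Conjugation by the cycle carries the transposition at \<open>i - 1\<close> to
      the one at \<open>i\<close>, the counterpart in permutations of the slide.\<close>
    have "(?s \<circ> ?c) j = (?c \<circ> ?t) j" for j
    proof -
      have "?k \<le> m" "m < n" using 3 k(1) Suc.prems(2) m by auto
      then consider "j = m" | "j = Suc m" | "j = Suc n" | "j < ?k" | "?k \<le> j" "j < m"
        | "Suc m < j" "j \<le> n" | "Suc n < j" by linarith
      then show ?thesis
        by cases (use \<open>?k \<le> m\<close> \<open>m < n\<close> m in \<open>simp_all add: c_apply transpose_def\<close>)
    qed
    then have cs: "?s \<circ> ?c = ?c \<circ> ?t" by (rule ext)
    then have comm: "w \<circ> ?s \<circ> ?c = w \<circ> ?c \<circ> ?t" by (simp only: comp_assoc)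
    have "(w \<circ> ?c) (i - 1) < (w \<circ> ?c) (Suc (i - 1))"
      using 3 k Suc.prems(2,3) m by (simp add: c_apply)
    then have IH: "artin_eq n (?a @ [i - 1]) (normal_word n (w \<circ> ?c \<circ> ?t))"
      using 3 k Suc.prems(2) by (intro Suc.IH[OF a]) auto
    have "artin_eq (Suc n) ([] @ (?a @ [i - 1]) @ rev [?k..<Suc n])
        ([] @ normal_word n (w \<circ> ?c \<circ> ?t) @ rev [?k..<Suc n])"
      by (rule artin_eq.append[OF artin_eq_mono[OF IH]]) (use k in auto)
    then have "artin_eq (Suc n) (?a @ (i - 1) # rev [?k..<Suc n]) (normal_word (Suc n) (w \<circ> ?s))"
      using inv' 3 comm by (simp add: Let_def transpose_def)
    moreover have "artin_eq (Suc n) (?a @ (rev [?k..<Suc n] @ [i]) @ [])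
        (?a @ ((i - 1) # rev [?k..<Suc n]) @ [])"
      by (rule artin_eq.append[OF artin_eq_slide]) (use 3 k a_set Suc.prems(2) in auto)
    ultimately have "artin_eq (Suc n) (?a @ rev [?k..<Suc n] @ [i]) (normal_word (Suc n) (w \<circ> ?s))"
      unfolding append_Nil2 by (rule artin_eq.trans[rotated])
    then show ?thesis by (simp only: normal_word.simps Let_def append_assoc)
  qed
qed simp

text \<open>Exchanging the two values turns the descent into an ascent, so the previous lemma
  applies to \<open>w \<circ> transpose i (Suc i)\<close>.\<close>

lemma normal_word_descent:
  assumes w: "w permutes {1..n}" and i: "i \<in> {1..<n}" and "\<not> w i < w (Suc i)"
  shows "artin_eq n (normal_word n w) (normal_word n (w \<circ> transpose i (Suc i)) @ [i])"
proof -
  let ?v = "w \<circ> transpose i (Suc i)"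
  have v: "?v permutes {1..n}"
    using i by (intro permutes_compose[OF _ w] permutes_swap_id) auto
  have "w i \<noteq> w (Suc i)" using permutes_inj[OF w] by (simp add: inj_eq)
  then have "?v i < ?v (Suc i)" using assms(3) by simp
  then have "artin_eq n (normal_word n ?v @ [i]) (normal_word n (?v \<circ> transpose i (Suc i)))"
    by (rule normal_word_ascent[OF v i])
  moreover have "?v \<circ> transpose i (Suc i) = w" by (simp add: comp_assoc)
  ultimately show ?thesis by (metis artin_eq.sym)
qed

section \<open>Lengths, reduced words and Matsumoto's theorem\<close>

lemma length_normal_word_le:
  assumes "set ks \<subseteq> {1..<n}"
  shows "length (normal_word n (perm_of_word ks)) \<le> length ks"
  using assms
proof (induction ks rule: rev_induct)
  case Nil
  show ?case
  proof (induction n)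
    case (Suc n)
    \<comment> \<open>The identity has its largest value in the last position, so every run is
      empty.\<close>
    have "inv_into UNIV (id :: nat \<Rightarrow> nat) (Suc n) = Suc n" by simp
    with Suc show ?case by (simp add: Let_def)
  qed simp
next
  case (snoc i ks)
  then have p: "perm_of_word ks permutes {1..n}" and i: "i \<in> {1..<n}"
    and IH: "length (normal_word n (perm_of_word ks)) \<le> length ks"
    using perm_of_word_permutes[of ks n] by auto
  have "length (normal_word n (perm_of_word ks \<circ> transpose i (Suc i))) \<le> Suc (length ks)"
  \<comment> \<open>An extra letter lengthens the normal word by one at an ascent and shortens it by
    one at a descent.\<close>
  proof (cases "perm_of_word ks i < perm_of_word ks (Suc i)")
    case True
    from artin_eq_length[OF normal_word_ascent[OF p i this]] IH show ?thesis by simp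
  next
    case False
    from artin_eq_length[OF normal_word_descent[OF p i this]] IH show ?thesis by simp
  qed
  then show ?case by (metis perm_of_word_snoc length_append_singleton)
qed

text \<open>Reducedness measured against the normal word instead of against all words for the same
  permutation. In this form it passes easily to prefixes.\<close>

definition tight_word :: "nat \<Rightarrow> nat list \<Rightarrow> bool" where
  "tight_word n ks \<longleftrightarrow>
     set ks \<subseteq> {1..<n} \<and> length (normal_word n (perm_of_word ks)) = length ks"

text \<open>At a descent the normal word of \<open>perm_of_word ks\<close> would be longer than that
  of the whole word, which exceeds the bound \<open>length ks\<close>.\<close>

lemma tight_word_snocD:
  assumes "tight_word n (ks @ [i])"
  shows "tight_word n ks" "perm_of_word ks i < perm_of_word ks (Suc i)"
proof -
  have ks: "set ks \<subseteq> {1..<n}" and i: "i \<in> {1..<n}"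
    and len: "length (normal_word n (perm_of_word ks \<circ> transpose i (Suc i))) = Suc (length ks)"
    using assms by (auto simp: tight_word_def)
  note p = perm_of_word_permutes[OF ks]
  show asc: "perm_of_word ks i < perm_of_word ks (Suc i)"
  proof (rule ccontr)
    assume "\<not> ?thesis"
    from artin_eq_length[OF normal_word_descent[OF p i this]] show False
      using length_normal_word_le[OF ks] len by simp
  qed
  show "tight_word n ks"
    using artin_eq_length[OF normal_word_ascent[OF p i asc]] ks len by (simp add: tight_word_def)
qed

text \<open>The normal word competes in the minimality clause and is itself never longer than
  \<open>ks\<close>.\<close>

lemma reduced_expression_tight:
  assumes "reduced_expression n \<pi> ks" "\<pi> permutes {1..n}"
  shows "tight_word n ks"
proof -
  have ks: "set ks \<subseteq> {1..<n}" "perm_of_word ks = \<pi>" and "length ks \<le> length (normal_word n \<pi>)"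
    using assms normal_word_set[of \<pi> n] perm_of_normal_word[of \<pi> n]
    unfolding reduced_expression_def by blast+
  with length_normal_word_le[OF ks(1)] show ?thesis by (simp add: tight_word_def)
qed

text \<open>Matsumoto's theorem relative to the normal form: in a tight word each new letter sits at
  an ascent, so the normal word is extended letter by letter. Hence the choice by
  \<open>SOME\<close> in \<open>neg_perm_braid\<close> is harmless.\<close>

lemma tight_word_normal:
  assumes "tight_word n ks"
  shows "artin_eq n ks (normal_word n (perm_of_word ks))"
  using assms
proof (induction ks rule: rev_induct)
  case Nil
  then have "normal_word n (perm_of_word []) = []" by (simp add: tight_word_def)
  then show ?case by (metis artin_eq.refl empty_set empty_subsetI)
next
  case (snoc i ks)
  note t = tight_word_snocD[OF snoc.prems]
  have ks: "set ks \<subseteq> {1..<n}" and i: "i \<in> {1..<n}" using snoc.prems by (auto simp: tight_word_def)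
  have "artin_eq n ([] @ ks @ [i]) ([] @ normal_word n (perm_of_word ks) @ [i])"
    using snoc.IH[OF t(1)] by (rule artin_eq.append) (use i in auto)
  then show ?case
    using normal_word_ascent[OF perm_of_word_permutes[OF ks] i t(2)]
    unfolding perm_of_word_snoc append_Nil by (rule artin_eq.trans)
qed

lemma reduced_expression_exists:
  assumes "\<pi> permutes {1..n}"
  shows "\<exists>ks. reduced_expression n \<pi> ks"
proof -
  have "length (normal_word n \<pi>) \<le> length js"
    if "set js \<subseteq> {1..<n}" "perm_of_word js = \<pi>" for js
    using length_normal_word_le[OF that(1)] unfolding that(2) .
  then show ?thesis
    unfolding reduced_expression_def
    using normal_word_set[OF assms] perm_of_normal_word[OF assms]
    by (intro exI[of _ "normal_word n \<pi>"] conjI allI impI) simp_all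
qed

section \<open>Braid words\<close>

lemma words_0 [simp]: "0 \<in> words n"
  by (simp add: words_def zero_braid_word_def)

lemma words_plus [simp]: "u + v \<in> words n \<longleftrightarrow> u \<in> words n \<and> v \<in> words n"
  by (auto simp: words_def plus_braid_word_def)

lemma words_Word: "Word ls \<in> words n \<longleftrightarrow> strand ` set ls \<subseteq> {1..<n}"
  by (simp add: words_def)

lemma words_neg [simp]: "Word (map Neg ks) \<in> words n \<longleftrightarrow> set ks \<subseteq> {1..<n}"
  by (simp add: words_Word image_image)

lemma words_mono: "n \<le> m \<Longrightarrow> words n \<subseteq> words m"
  by (force simp: words_def)

lemma word_append: "Word (ls @ ms) = Word ls + Word ms"
  by (simp add: plus_braid_word_def)

lemma braid_relators_words: "(u, v) \<in> braid_relators n \<Longrightarrow> u \<in> words n \<and> v \<in> words n"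
  by (auto simp: braid_relators_def words_Word)

lemma braid_eq_words: "(u, v) \<in> braid_eq n \<Longrightarrow> u \<in> words n \<and> v \<in> words n"
  by (induction rule: braid_eq.induct) (auto dest: braid_relators_words)

lemma equiv_braid_eq: "equiv (words n) (braid_eq n)"
proof (rule equivI)
  show "braid_eq n \<subseteq> words n \<times> words n" by (auto dest: braid_eq_words)
  show "refl_on (words n) (braid_eq n)" by (auto simp: refl_on_def intro: braid_eq.refl)
  show "sym (braid_eq n)" by (auto simp: sym_def intro: braid_eq.sym)
  show "trans (braid_eq n)" by (auto simp: trans_def intro: braid_eq.trans)
qed

lemma braid_eq_plus:
  assumes "(u, u') \<in> braid_eq n" "(v, v') \<in> braid_eq n"
  shows "(u + v, u' + v') \<in> braid_eq n"
proof -
  note w = braid_eq_words[OF assms(1)] braid_eq_words[OF assms(2)]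
  have "(0 + u + v, 0 + u' + v) \<in> braid_eq n"
    by (rule braid_eq.cong) (use w assms in auto)
  moreover have "(u' + v + 0, u' + v' + 0) \<in> braid_eq n"
    by (rule braid_eq.cong) (use w assms in auto)
  ultimately show ?thesis by (auto intro: braid_eq.trans)
qed

section \<open>Reversal of braid words\<close>

lemma word_rev_plus: "word_rev (u + v) = word_rev v + word_rev u"
  by (simp add: word_rev_def plus_braid_word_def)

lemma word_rev_words [simp]: "word_rev w \<in> words n \<longleftrightarrow> w \<in> words n"
  by (simp add: word_rev_def words_def)

text \<open>Reversal exchanges the two kinds of cancellation, swaps the indices of a commutation and
  fixes both sides of a braid relator, which are palindromes.\<close>

lemma braid_relators_rev:
  "(u, v) \<in> braid_relators n \<Longrightarrow> (word_rev u, word_rev v) \<in> braid_relators n"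
  unfolding braid_relators_def word_rev_def zero_braid_word_def by auto

lemma braid_eq_rev: "(u, v) \<in> braid_eq n \<Longrightarrow> (word_rev u, word_rev v) \<in> braid_eq n"
proof (induction rule: braid_eq.induct)
  case (cong u v a b)
  then show ?case
    using braid_eq.cong[of "word_rev u" "word_rev v" n "word_rev b" "word_rev a"]
    by (simp add: word_rev_plus add.assoc)
next
  case (relator u v)
  then show ?case by (intro braid_eq.relator braid_relators_rev)
next
  case (refl w)
  then show ?case by (intro braid_eq.refl) simp
qed (blast intro: braid_eq.sym braid_eq.trans)+

section \<open>Inverses in the braid group\<close>

fun letter_inv :: "letter \<Rightarrow> letter" where
  "letter_inv (Pos i) = Neg i"
| "letter_inv (Neg i) = Pos i"

text \<open>The commutation and braid relators are given for positive letters only; inverse words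
  carry them over to negative letters.\<close>

definition word_inv :: "braid_word \<Rightarrow> braid_word" where
  "word_inv w = Word (rev (map letter_inv (letters w)))"

lemma letter_inv_inv [simp]: "letter_inv (letter_inv l) = l"
  by (cases l) auto

lemma strand_letter_inv [simp]: "strand (letter_inv l) = strand l"
  by (cases l) auto

lemma word_inv_inv [simp]: "word_inv (word_inv w) = w"
  by (simp add: word_inv_def rev_map comp_def)

lemma word_inv_words [simp]: "word_inv w \<in> words n \<longleftrightarrow> w \<in> words n"
  by (simp add: word_inv_def words_def image_image)

lemma braid_eq_letter_inv:
  assumes "strand l \<in> {1..<n}"
  shows "(Word [l] + Word [letter_inv l], 0) \<in> braid_eq n"
  using assms by (cases l) (auto simp: plus_braid_word_def braid_relators_def intro!: braid_eq.relator)

lemma braid_eq_inv_right: "w \<in> words n \<Longrightarrow> (w + word_inv w, 0) \<in> braid_eq n"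
proof (induction w)
  case (Word ls)
  then show ?case
  proof (induction ls)
    case Nil
    have "Word [] + word_inv (Word []) = 0" by (simp add: word_inv_def plus_braid_word_def zero_braid_word_def)
    then show ?case by (simp add: braid_eq.refl)
  next
    case (Cons l ls)
    have "Word (l # ls) + word_inv (Word (l # ls)) =
        Word [l] + (Word ls + word_inv (Word ls)) + Word [letter_inv l]"
      by (simp add: word_inv_def plus_braid_word_def)
    moreover have "(Word [l] + (Word ls + word_inv (Word ls)) + Word [letter_inv l],
        Word [l] + 0 + Word [letter_inv l]) \<in> braid_eq n"
      using Cons by (intro braid_eq.cong) (auto simp: words_Word)
    moreover have "(Word [l] + 0 + Word [letter_inv l], 0) \<in> braid_eq n"
      using Cons.prems braid_eq_letter_inv[of l n] by (simp add: words_Word)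
    ultimately show ?case by (metis braid_eq.trans)
  qed
qed

lemma braid_eq_inv_left: "w \<in> words n \<Longrightarrow> (word_inv w + w, 0) \<in> braid_eq n"
  using braid_eq_inv_right[of "word_inv w" n] by simp

text \<open>The group computation \<open>u^-1 = u^-1 v v^-1 = u^-1 u v^-1 = v^-1\<close>, on words
  modulo \<open>braid_eq\<close>.\<close>

lemma braid_eq_inv:
  assumes "(u, v) \<in> braid_eq n"
  shows "(word_inv u, word_inv v) \<in> braid_eq n"
proof -
  have uv: "u \<in> words n" "v \<in> words n" using braid_eq_words[OF assms] by auto
  have refl: "(word_inv u, word_inv u) \<in> braid_eq n" "(word_inv v, word_inv v) \<in> braid_eq n"
    using uv by (auto intro: braid_eq.refl)
  have "(word_inv u + 0, word_inv u + (v + word_inv v)) \<in> braid_eq n"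
    by (rule braid_eq_plus[OF refl(1) braid_eq.sym[OF braid_eq_inv_right[OF uv(2)]]])
  moreover have "(word_inv u + (v + word_inv v), word_inv u + (u + word_inv v)) \<in> braid_eq n"
    by (rule braid_eq_plus[OF refl(1) braid_eq_plus[OF braid_eq.sym[OF assms] refl(2)]])
  moreover have "(word_inv u + u + word_inv v, 0 + word_inv v) \<in> braid_eq n"
    by (rule braid_eq_plus[OF braid_eq_inv_left[OF uv(1)] refl(2)])
  ultimately show ?thesis
    unfolding add.assoc[symmetric] add_0_left add_0_right by (meson braid_eq.trans)
qed

lemma artin_eq_braid_eq:
  assumes "artin_eq n u v"
  shows "(Word (map Neg u), Word (map Neg v)) \<in> braid_eq n"
  using assms
proof (induction rule: artin_eq.induct)
  case (refl u)
  then show ?case by (intro braid_eq.refl) simp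
next
  case (append u v a b)
  then have "(Word (map Neg a) + Word (map Neg u) + Word (map Neg b),
      Word (map Neg a) + Word (map Neg v) + Word (map Neg b)) \<in> braid_eq n"
    by (intro braid_eq.cong) auto
  then show ?case by (simp add: plus_braid_word_def)
next
  case (commute i j)
  \<comment> \<open>Inversion reverses words, so the relator is taken with \<open>i\<close> and
    \<open>j\<close> exchanged.\<close>
  then have "(Word [Pos j, Pos i], Word [Pos i, Pos j]) \<in> braid_eq n"
    by (intro braid_eq.relator) (auto simp: braid_relators_def)
  from braid_eq_inv[OF this] show ?case by (simp add: word_inv_def)
next
  case (braid i)
  then have "(Word [Pos i, Pos (Suc i), Pos i], Word [Pos (Suc i), Pos i, Pos (Suc i)]) \<in> braid_eq n"
    by (intro braid_eq.relator) (auto simp: braid_relators_def)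
  from braid_eq_inv[OF this] show ?case by (simp add: word_inv_def)
qed (blast intro: braid_eq.sym braid_eq.trans)+

section \<open>The Hecke algebra as a quotient\<close>

lemma carrier_free_algebra: "f \<in> carrier (free_algebra n) \<longleftrightarrow> Poly_Mapping.keys f \<subseteq> words n"
  by (simp add: free_algebra_def)

lemma free_algebra_simps [simp]:
  "f \<otimes>\<^bsub>free_algebra n\<^esub> g = f * g" "f \<oplus>\<^bsub>free_algebra n\<^esub> g = f + g"
  "\<one>\<^bsub>free_algebra n\<^esub> = 1" "\<zero>\<^bsub>free_algebra n\<^esub> = 0"
  by (simp_all add: free_algebra_def)

lemma carrier_free_mult [intro]:
  assumes "f \<in> carrier (free_algebra n)" "g \<in> carrier (free_algebra n)"
  shows "f * g \<in> carrier (free_algebra n)"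
  using assms keys_mult[of f g] by (fastforce simp: carrier_free_algebra)

lemma carrier_free_add [intro]:
  assumes "f \<in> carrier (free_algebra n)" "g \<in> carrier (free_algebra n)"
  shows "f + g \<in> carrier (free_algebra n)"
  using assms Poly_Mapping.keys_add[of f g] by (auto simp: carrier_free_algebra)

lemma carrier_free_diff [intro]:
  assumes "f \<in> carrier (free_algebra n)" "g \<in> carrier (free_algebra n)"
  shows "f - g \<in> carrier (free_algebra n)"
  using assms keys_diff[of f g] by (auto simp: carrier_free_algebra)

lemma carrier_of_word: "of_word w \<in> carrier (free_algebra n) \<longleftrightarrow> w \<in> words n"
  by (simp add: carrier_free_algebra of_word_def)

lemma carrier_scalar [intro!, simp]: "scalar c \<in> carrier (free_algebra n)"
  by (simp add: carrier_free_algebra scalar_def)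

lemma of_word_plus: "of_word (u + v) = of_word u * of_word v"
  by (simp add: of_word_def mult_single)

lemma of_word_0: "of_word 0 = 1"
  by (simp add: of_word_def)

lemma ring_free_algebra: "ring (free_algebra n)"
proof (rule ringI)
  show "abelian_group (free_algebra n)"
  proof (rule abelian_groupI)
    fix f assume "f \<in> carrier (free_algebra n)"
    then show "\<exists>g\<in>carrier (free_algebra n). g \<oplus>\<^bsub>free_algebra n\<^esub> f = \<zero>\<^bsub>free_algebra n\<^esub>"
      by (intro bexI[of _ "- f"]) (auto simp: carrier_free_algebra)
  qed (auto simp: carrier_free_algebra[of 0] add_ac)
  show "Group.monoid (free_algebra n)"
    by (rule monoidI) (auto simp: carrier_free_algebra[of 1] mult.assoc)
qed (auto simp: algebra_simps)

lemma hecke_relators_carrier: "hecke_relators n \<subseteq> carrier (free_algebra n)"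
  unfolding hecke_relators_def
  by (auto simp: carrier_of_word words_Word dest: braid_relators_words intro!: carrier_free_diff)

lemma ideal_hecke_ideal: "ideal (hecke_ideal n) (free_algebra n)"
  unfolding hecke_ideal_def by (rule ring.genideal_ideal[OF ring_free_algebra hecke_relators_carrier])

lemma hecke_relators_ideal: "hecke_relators n \<subseteq> hecke_ideal n"
  unfolding hecke_ideal_def by (rule ring.genideal_self[OF ring_free_algebra hecke_relators_carrier])

lemma free_algebra_minus:
  assumes "f \<in> carrier (free_algebra n)" "g \<in> carrier (free_algebra n)"
  shows "f \<ominus>\<^bsub>free_algebra n\<^esub> g = f - g"
proof -
  interpret ring "free_algebra n" by (rule ring_free_algebra)
  have "- g \<in> carrier (free_algebra n)" using assms(2) by (simp add: carrier_free_algebra)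
  then have "\<ominus>\<^bsub>free_algebra n\<^esub> g = - g" using assms(2) by (intro minus_equality) auto
  then show ?thesis by (simp add: a_minus_def)
qed

lemma hecke_class_eq_iff:
  assumes "f \<in> carrier (free_algebra n)" "g \<in> carrier (free_algebra n)"
  shows "hecke_class n f = hecke_class n g \<longleftrightarrow> f - g \<in> hecke_ideal n"
  using ring.quotient_eq_iff_same_a_r_cos[OF ring_free_algebra ideal_hecke_ideal assms]
  by (simp add: hecke_class_def free_algebra_minus[OF assms])

lemma hecke_ring_hom: "hecke_class n \<in> ring_hom (free_algebra n) (hecke_algebra n)"
  using ideal.rcos_ring_hom[OF ideal_hecke_ideal[of n]] by (simp add: hecke_class_def[abs_def] hecke_algebra_def)

lemma hecke_class_carrier:
  "f \<in> carrier (free_algebra n) \<Longrightarrow> hecke_class n f \<in> carrier (hecke_algebra n)"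
  using ring_hom_closed[OF hecke_ring_hom] .

lemma hecke_class_mult:
  assumes "f \<in> carrier (free_algebra n)" "g \<in> carrier (free_algebra n)"
  shows "hecke_class n (f * g) = hecke_class n f \<otimes>\<^bsub>hecke_algebra n\<^esub> hecke_class n g"
  using ring_hom_mult[OF hecke_ring_hom assms] by simp

lemma hecke_class_add:
  assumes "f \<in> carrier (free_algebra n)" "g \<in> carrier (free_algebra n)"
  shows "hecke_class n (f + g) = hecke_class n f \<oplus>\<^bsub>hecke_algebra n\<^esub> hecke_class n g"
  using ring_hom_add[OF hecke_ring_hom assms] by simp

lemma hecke_class_one: "hecke_class n 1 = \<one>\<^bsub>hecke_algebra n\<^esub>"
  using ring_hom_one[OF hecke_ring_hom, of n] by simp

lemma hecke_class_braid_eq: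
  assumes "(u, v) \<in> braid_eq n"
  shows "hecke_class n (of_word u) = hecke_class n (of_word v)"
  using assms
proof (induction rule: braid_eq.induct)
  case (relator u v)
  then have "of_word u - of_word v \<in> hecke_relators n" by (auto simp: hecke_relators_def)
  then show ?case
    using relator hecke_relators_ideal
    by (subst hecke_class_eq_iff) (auto simp: carrier_of_word dest: braid_relators_words)
next
  case (cong u v a b)
  then show ?case
    using braid_eq_words[OF cong.hyps(1)]
    by (simp add: of_word_plus hecke_class_mult carrier_of_word carrier_free_mult)
qed auto

text \<open>The larger ideal, cut down to the smaller free algebra, is an ideal there and contains
  the smaller set of relators; minimality of the generated ideal gives the rest.\<close>

lemma hecke_ideal_mono: "hecke_ideal n \<subseteq> hecke_ideal (Suc n)"
proof -
  let ?A = "free_algebra n" and ?B = "free_algebra (Suc n)"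
  let ?J = "carrier ?A \<inter> hecke_ideal (Suc n)"
  have sub: "carrier ?A \<subseteq> carrier ?B"
    using words_mono[of n "Suc n"] by (auto simp: carrier_free_algebra)
  interpret I: ideal "hecke_ideal (Suc n)" ?B by (rule ideal_hecke_ideal)
  note J_add = I.additive_subgroup_axioms
  have "ideal ?J ?A"
  proof (rule idealI[OF ring_free_algebra])
    interpret A: ring ?A by (rule ring_free_algebra)
    show "subgroup ?J (add_monoid ?A)"
    proof (rule group.subgroupI)
      show "Group.group (add_monoid ?A)" by (rule A.a_group)
      show "?J \<noteq> {}" using additive_subgroup.zero_closed[OF J_add] A.zero_closed by auto
    next
      \<comment> \<open>\<open>- f\<close> is the additive inverse of \<open>f\<close> in both
        algebras, so closure under it can be taken from the larger ideal.\<close>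
      fix f assume f: "f \<in> ?J"
      then have "0 - f \<in> carrier ?A" using A.zero_closed by (intro carrier_free_diff) auto
      then have 1: "- f \<in> carrier ?A" by simp
      then have "inv\<^bsub>add_monoid ?A\<^esub> f = - f"
        using f A.minus_equality[of "- f" f] by (simp add: a_inv_def)
      moreover have "\<ominus>\<^bsub>?B\<^esub> f = - f"
        using f sub 1 I.minus_equality[of "- f" f] by auto
      ultimately show "inv\<^bsub>add_monoid ?A\<^esub> f \<in> ?J"
        using additive_subgroup.a_inv_closed[OF J_add, of f] f 1 by auto
    next
      fix f g assume "f \<in> ?J" "g \<in> ?J"
      then show "f \<otimes>\<^bsub>add_monoid ?A\<^esub> g \<in> ?J"
        using additive_subgroup.a_closed[OF J_add, of f g] by auto
    qed auto
  next
    fix f g assume "f \<in> ?J" "g \<in> carrier ?A"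
    then show "g \<otimes>\<^bsub>?A\<^esub> f \<in> ?J" "f \<otimes>\<^bsub>?A\<^esub> g \<in> ?J"
      using I.I_l_closed[of f g] I.I_r_closed[of f g] sub by auto
  qed
  moreover have "hecke_relators n \<subseteq> ?J"
  proof -
    have "hecke_relators n \<subseteq> hecke_relators (Suc n)"
      unfolding hecke_relators_def braid_relators_def by fastforce
    then show ?thesis using hecke_relators_carrier hecke_relators_ideal by blast
  qed
  ultimately show ?thesis
    unfolding hecke_ideal_def[of n] using ring.genideal_minimal[OF ring_free_algebra] by blast
qed

text \<open>Representatives of one class differ by an element of the smaller ideal, hence of the
  larger one, so the union in \<open>hecke_inclusion\<close> yields a single class.\<close>

lemma hecke_inclusion_class:
  assumes f: "f \<in> carrier (free_algebra n)"
  shows "hecke_inclusion n (hecke_class n f) = hecke_class (Suc n) f"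
proof -
  interpret I: ideal "hecke_ideal n" "free_algebra n" by (rule ideal_hecke_ideal)
  have sub: "carrier (free_algebra n) \<subseteq> carrier (free_algebra (Suc n))"
    using words_mono[of n "Suc n"] by (auto simp: carrier_free_algebra)
  have "f \<in> hecke_class n f" using f unfolding hecke_class_def by (rule I.a_rcos_self)
  moreover have "hecke_class (Suc n) g = hecke_class (Suc n) f" if "g \<in> hecke_class n f" for g
  proof -
    obtain h where h: "h \<in> hecke_ideal n" and g: "g = h + f"
      using \<open>g \<in> hecke_class n f\<close> by (auto simp: hecke_class_def a_r_coset_def')
    have "g \<in> carrier (free_algebra n)" using f g I.Icarr[OF h] by auto
    then show ?thesis
      using f sub h g hecke_ideal_mono by (subst hecke_class_eq_iff) auto
  qed
  ultimately show ?thesis unfolding hecke_inclusion_def by blast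
qed

section \<open>Braid operations computed on representatives\<close>

lemma hecke_of_braid_class:
  assumes "w \<in> words n"
  shows "hecke_of_braid n (braid_eq n `` {w}) = hecke_class n (of_word w)"
  unfolding hecke_of_braid_def
  by (rule UN_equiv_class[OF equiv_braid_eq _ assms]) (auto intro!: congruentI hecke_class_braid_eq)

lemma braid_star_class:
  assumes "w \<in> words n"
  shows "braid_star n (braid_eq n `` {w}) = braid_eq n `` {word_rev w}"
  unfolding braid_star_def
  by (rule UN_equiv_class[OF equiv_braid_eq _ assms])
    (auto intro!: congruentI equiv_class_eq[OF equiv_braid_eq] braid_eq_rev)

lemma braid_mult_class:
  assumes "u \<in> words n" "v \<in> words n"
  shows "braid_eq n `` {u} \<otimes>\<^bsub>braid_group n\<^esub> braid_eq n `` {v} = braid_eq n `` {u + v}"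
  unfolding braid_group_def monoid.simps
  by (rule UN_equiv_class2[OF equiv_braid_eq equiv_braid_eq _ assms])
    (auto intro!: congruent2I' equiv_class_eq[OF equiv_braid_eq] braid_eq_plus)

section \<open>The trace at \<open>T = z\<close>\<close>

text \<open>The argument \<open>f\<close> is a representative in the free algebra, so products are
  plain \<open>*\<close>. The point \<open>[:0, 1:]\<close> has type \<open>int poly\<close>, where
  it is the variable z, substituted here for T.\<close>

definition trace_at_z :: "(nat \<Rightarrow> free_elem set \<Rightarrow> int poly poly) \<Rightarrow> nat \<Rightarrow> free_elem \<Rightarrow> int poly" where
  "trace_at_z Tr n f = poly (Tr n (hecke_class n f)) [:0, 1:]"

definition neg_word :: "nat list \<Rightarrow> free_elem" where
  "neg_word ks = of_word (Word (map Neg ks))"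

lemma neg_word_append: "neg_word (us @ vs) = neg_word us * neg_word vs"
  by (simp add: neg_word_def word_append of_word_plus)

lemma neg_word_Nil: "neg_word [] = 1"
  by (simp add: neg_word_def of_word_0 flip: zero_braid_word_def)

lemma neg_word_carrier: "set ks \<subseteq> {1..<n} \<Longrightarrow> neg_word ks \<in> carrier (free_algebra n)"
  by (simp add: neg_word_def carrier_of_word)

context
  fixes Tr
  assumes Tr: "ocneanu_trace Tr"
begin

section \<open>The trace axioms at T = z\<close>

lemma trace_at_z_cong:
  assumes "f \<in> carrier (free_algebra n)" "g \<in> carrier (free_algebra n)" "f - g \<in> hecke_ideal n"
  shows "trace_at_z Tr n f = trace_at_z Tr n g"
  using hecke_class_eq_iff[OF assms(1,2)] assms(3) by (simp add: trace_at_z_def)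

lemma trace_at_z_add:
  assumes "1 \<le> n" "f \<in> carrier (free_algebra n)" "g \<in> carrier (free_algebra n)"
  shows "trace_at_z Tr n (f + g) = trace_at_z Tr n f + trace_at_z Tr n g"
  using Tr assms by (simp add: ocneanu_trace_def trace_at_z_def hecke_class_add hecke_class_carrier)

lemma trace_at_z_scalar:
  assumes "1 \<le> n" "f \<in> carrier (free_algebra n)"
  shows "trace_at_z Tr n (scalar c * f) = c * trace_at_z Tr n f"
proof -
  have "hecke_class n (scalar c * f) = hecke_smult n c (hecke_class n f)"
    using assms by (simp add: hecke_smult_def hecke_class_mult)
  then show ?thesis using Tr assms
    by (simp add: ocneanu_trace_def trace_at_z_def hecke_class_carrier)
qed

lemma trace_at_z_comm:
  assumes "1 \<le> n" "f \<in> carrier (free_algebra n)" "g \<in> carrier (free_algebra n)"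
  shows "trace_at_z Tr n (f * g) = trace_at_z Tr n (g * f)"
  using Tr assms by (simp add: ocneanu_trace_def trace_at_z_def hecke_class_mult hecke_class_carrier)

lemma trace_at_z_one: "1 \<le> n \<Longrightarrow> trace_at_z Tr n 1 = 1"
  using Tr by (simp add: ocneanu_trace_def trace_at_z_def hecke_class_one)

lemma trace_at_z_inclusion:
  assumes "1 \<le> n" "f \<in> carrier (free_algebra n)"
  shows "trace_at_z Tr (Suc n) f = trace_at_z Tr n f"
proof -
  have "Tr (Suc n) (hecke_inclusion n (hecke_class n f)) = Tr n (hecke_class n f)"
    using Tr assms by (simp add: ocneanu_trace_def hecke_class_carrier)
  then show ?thesis by (simp add: trace_at_z_def hecke_inclusion_class[OF assms(2)])
qed

lemma trace_at_z_sigma: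
  assumes "1 \<le> n" "f \<in> carrier (free_algebra n)"
  shows "trace_at_z Tr (Suc n) (f * of_word (Word [Pos n])) = [:0, 1:] * trace_at_z Tr n f"
proof -
  have f: "f \<in> carrier (free_algebra (Suc n))"
    using assms words_mono[of n "Suc n"] by (auto simp: carrier_free_algebra)
  have p: "of_word (Word [Pos n]) \<in> carrier (free_algebra (Suc n))"
    using assms by (simp add: carrier_of_word words_Word)
  have "Tr (Suc n) (hecke_inclusion n (hecke_class n f) \<otimes>\<^bsub>hecke_algebra (Suc n)\<^esub> hecke_sigma (Suc n) n) =
      [:0, 1:] * Tr n (hecke_class n f)"
    using Tr assms hecke_class_carrier[OF assms(2)] unfolding ocneanu_trace_def by blast
  then have "Tr (Suc n) (hecke_class (Suc n) (f * of_word (Word [Pos n]))) = [:0, 1:] * Tr n (hecke_class n f)"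
    by (simp only: hecke_inclusion_class[OF assms(2)] hecke_sigma_def hecke_class_mult[OF f p])
  then show ?thesis by (simp add: trace_at_z_def)
qed

text \<open>The skein relator times \<open>f\<close> lies in the ideal, so expanding the product
  gives an identity of classes.\<close>

lemma trace_at_z_skein:
  assumes "1 \<le> n" "i \<in> {1..<n}" "f \<in> carrier (free_algebra n)"
  shows "trace_at_z Tr n (of_word (Word [Pos i]) * f) =
    trace_at_z Tr n (neg_word [i] * f) + [:0, 1:] * trace_at_z Tr n f"
proof -
  let ?p = "of_word (Word [Pos i])" and ?n = "neg_word [i]" and ?z = "scalar [:0, 1:]"
  have p: "?p \<in> carrier (free_algebra n)" using assms(2) by (simp add: carrier_of_word words_Word)
  have n: "?n \<in> carrier (free_algebra n)" using assms(2) by (intro neg_word_carrier) simp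
  have "?p - ?n - ?z \<in> hecke_relators n"
    using assms(2) by (auto simp: hecke_relators_def neg_word_def)
  then have "(?p - ?n - ?z) * f \<in> hecke_ideal n"
    using hecke_relators_ideal[of n] ideal.I_r_closed[OF ideal_hecke_ideal, of _ n f] assms(3) by auto
  then have "trace_at_z Tr n (?p * f) = trace_at_z Tr n (?n * f + ?z * f)"
    by (intro trace_at_z_cong) (use p n assms(3) in \<open>auto simp: algebra_simps\<close>)
  also have "\<dots> = trace_at_z Tr n (?n * f) + trace_at_z Tr n (?z * f)"
    using assms p n by (intro trace_at_z_add) auto
  also have "trace_at_z Tr n (?z * f) = [:0, 1:] * trace_at_z Tr n f"
    using assms by (intro trace_at_z_scalar)
  finally show ?thesis .
qed

section \<open>Traces of products of negative letters\<close>

lemma trace_neg_artin_eq: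
  assumes "artin_eq n u v"
  shows "trace_at_z Tr n (neg_word u) = trace_at_z Tr n (neg_word v)"
  using hecke_class_braid_eq[OF artin_eq_braid_eq[OF assms]] by (simp add: trace_at_z_def neg_word_def)

lemma trace_neg_comm:
  assumes "1 \<le> n" "set u \<subseteq> {1..<n}" "set v \<subseteq> {1..<n}"
  shows "trace_at_z Tr n (neg_word (u @ v)) = trace_at_z Tr n (neg_word (v @ u))"
  using assms by (simp add: neg_word_append trace_at_z_comm neg_word_carrier)

text \<open>The Markov rule and the skein relation both evaluate the trace with a positive letter
  \<open>n\<close>. At T = z they share the term z times the trace of \<open>u\<close>, which
  cancels.\<close>

lemma trace_neg_top:
  assumes "1 \<le> n" "set u \<subseteq> {1..<n}"
  shows "trace_at_z Tr (Suc n) (neg_word (u @ [n])) = 0"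
proof -
  let ?p = "of_word (Word [Pos n])" and ?u = "neg_word u"
  have "{1..<n} \<subseteq> {1..<Suc n}" by auto
  then have u: "?u \<in> carrier (free_algebra (Suc n))"
    using assms(2) by (intro neg_word_carrier) (rule subset_trans)
  have p: "?p \<in> carrier (free_algebra (Suc n))" "neg_word [n] \<in> carrier (free_algebra (Suc n))"
    using assms(1) by (simp_all add: carrier_of_word words_Word neg_word_carrier)
  have "[:0, 1:] * trace_at_z Tr n ?u = trace_at_z Tr (Suc n) (?u * ?p)"
    using trace_at_z_sigma[OF assms(1) neg_word_carrier[OF assms(2)]] by simp
  \<comment> \<open>The skein lemma acts on the first letter; cyclicity brings the letter to the
    front and later carries its inverse back.\<close>
  also have "\<dots> = trace_at_z Tr (Suc n) (?p * ?u)"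
    by (rule trace_at_z_comm[OF _ u p(1)]) simp
  also have "\<dots> = trace_at_z Tr (Suc n) (neg_word [n] * ?u) + [:0, 1:] * trace_at_z Tr (Suc n) ?u"
    using assms(1) u by (intro trace_at_z_skein) auto
  also have "trace_at_z Tr (Suc n) ?u = trace_at_z Tr n ?u"
    using assms by (intro trace_at_z_inclusion neg_word_carrier)
  also have "trace_at_z Tr (Suc n) (neg_word [n] * ?u) = trace_at_z Tr (Suc n) (?u * neg_word [n])"
    by (rule trace_at_z_comm[OF _ p(2) u]) simp
  finally show ?thesis by (simp add: neg_word_append)
qed

text \<open>The skein relation is applied to \<open>neg_word (i # v @ u)\<close>: a positive letter
  in front cancels the leading \<open>i\<close>, a negative one doubles it. Cyclicity puts
  \<open>u\<close> back in front.\<close>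

lemma trace_neg_square:
  assumes "1 \<le> n" "i \<in> {1..<n}" "set u \<subseteq> {1..<n}" "set v \<subseteq> {1..<n}"
  shows "trace_at_z Tr n (neg_word (u @ [i, i] @ v)) =
    trace_at_z Tr n (neg_word (u @ v)) - [:0, 1:] * trace_at_z Tr n (neg_word (u @ [i] @ v))"
proof -
  let ?F = "\<lambda>ks. trace_at_z Tr n (neg_word ks)"
  let ?p = "of_word (Word [Pos i])"
  have x: "neg_word (i # v @ u) \<in> carrier (free_algebra n)"
    using assms by (intro neg_word_carrier) auto
  have "(Word [Pos i] + Word (map Neg (i # v @ u)), 0 + Word (map Neg (v @ u))) \<in> braid_eq n"
  proof -
    have "(Word [Pos i] + Word [Neg i] + Word (map Neg (v @ u)), 0 + Word (map Neg (v @ u))) \<in> braid_eq n"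
      using assms by (intro braid_eq_plus braid_eq_inv_right[of "Word [Pos i]", unfolded word_inv_def, simplified] braid_eq.refl)
        (auto simp: words_Word)
    then show ?thesis by (simp add: plus_braid_word_def)
  qed
  from hecke_class_braid_eq[OF this] have "trace_at_z Tr n (?p * neg_word (i # v @ u)) = ?F (v @ u)"
    by (simp add: trace_at_z_def neg_word_def of_word_plus)
  moreover have "trace_at_z Tr n (?p * neg_word (i # v @ u)) =
      trace_at_z Tr n (neg_word [i] * neg_word (i # v @ u)) + [:0, 1:] * ?F (i # v @ u)"
    by (rule trace_at_z_skein[OF assms(1,2) x])
  moreover have "neg_word [i] * neg_word (i # v @ u) = neg_word ([i, i] @ v @ u)"
    using neg_word_append[of "[i]" "i # v @ u"] by simp
  moreover have "?F (u @ ks @ v) = ?F (ks @ v @ u)" if "set ks \<subseteq> {1..<n}" for ks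
    using trace_neg_comm[OF assms(1,3), of "ks @ v"] assms(4) that by simp
  from this[of "[i, i]"] this[of "[i]"] this[of "[]"]
  have "?F (u @ [i, i] @ v) = ?F ([i, i] @ v @ u)" "?F (u @ [i] @ v) = ?F (i # v @ u)"
    "?F (u @ v) = ?F (v @ u)"
    using assms(2) by simp_all
  ultimately show ?thesis by simp
qed

text \<open>Either the final run is empty and the trace descends to \<open>n\<close> strands, or the
  run contains the only occurrence of the letter \<open>n\<close>. In the second case rotation puts
  that letter last and \<open>trace_neg_top\<close> applies.\<close>

lemma trace_neg_normal_word:
  assumes "1 \<le> n" "w permutes {1..n}"
  shows "trace_at_z Tr n (neg_word (normal_word n w)) = (if w = id then 1 else 0)"
  using assms
proof (induction n arbitrary: w rule: nat_induct_at_least)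
  case base
  have "w = id" using base by simp
  moreover have "normal_word 1 w = []" using normal_word_set[OF base] by simp
  ultimately show ?case by (simp add: neg_word_Nil trace_at_z_one)
next
  case (Suc n)
  let ?k = "inv_into UNIV w (Suc n)"
  let ?a = "w \<circ> perm_of_word [?k..<Suc n]"
  note k = top_position[OF Suc.prems] and a = delete_top_permutes[OF Suc.prems]
  have a_set: "set (normal_word n ?a) \<subseteq> {1..<n}" by (rule normal_word_set[OF a])
  have "{1..<n} \<subseteq> {1..<Suc n}" by auto
  with a_set have a_set': "set (normal_word n ?a) \<subseteq> {1..<Suc n}" by (rule subset_trans)
  have nw: "normal_word (Suc n) w = normal_word n ?a @ rev [?k..<Suc n]"
    by (simp only: normal_word.simps Let_def)
  show ?case
  proof (cases "?k = Suc n")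
    case True
    then have "?a = w" "normal_word (Suc n) w = normal_word n ?a"
      unfolding nw by simp_all
    then have "trace_at_z Tr (Suc n) (neg_word (normal_word (Suc n) w)) =
        trace_at_z Tr n (neg_word (normal_word n ?a))"
      using trace_at_z_inclusion[OF Suc.hyps(1) neg_word_carrier[OF a_set]] by simp
    also have "\<dots> = (if ?a = id then 1 else 0)"
      by (rule Suc.IH[OF a])
    finally show ?thesis unfolding \<open>?a = w\<close> .
  next
    case False
    with k have "w \<noteq> id" by auto
    have split: "rev [?k..<Suc n] = [n] @ rev [?k..<n]"
      using False k by (simp add: upt_Suc)
    have rest: "set (rev [?k..<n]) \<subseteq> {1..<n}" using k by auto
    have "{1..<n} \<subseteq> {1..<Suc n}" by auto
    with rest have rest': "set (rev [?k..<n]) \<subseteq> {1..<Suc n}" by (rule subset_trans)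
    have top: "set (normal_word n ?a @ [n]) \<subseteq> {1..<Suc n}"
      using a_set' Suc.hyps(1) by simp
    have "trace_at_z Tr (Suc n) (neg_word ((normal_word n ?a @ [n]) @ rev [?k..<n])) =
        trace_at_z Tr (Suc n) (neg_word (rev [?k..<n] @ normal_word n ?a @ [n]))"
      by (rule trace_neg_comm[OF _ top rest']) simp
    also have "\<dots> = 0"
      using trace_neg_top[of n "rev [?k..<n] @ normal_word n ?a"] Suc.hyps(1) a_set rest by simp
    finally show ?thesis
      using \<open>w \<noteq> id\<close> unfolding nw split by (simp only: append_assoc if_False)
  qed
qed

text \<open>The left factor stays in normal form and ranges over all permutations, so that the
  induction can strip the last letter of the tight word and absorb it into \<open>w\<close>.\<close>

lemma trace_neg_orthonormal:
  assumes "1 \<le> n" "w permutes {1..n}" "tight_word n ks"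
  shows "trace_at_z Tr n (neg_word (normal_word n w @ rev ks)) = (if w = perm_of_word ks then 1 else 0)"
  using assms(2,3)
proof (induction ks arbitrary: w rule: rev_induct)
  case Nil
  show ?case
    unfolding perm_of_word_Nil rev.simps append_Nil2
    by (rule trace_neg_normal_word[OF assms(1) Nil(1)])
next
  case (snoc i ks)
  let ?F = "\<lambda>ks. trace_at_z Tr n (neg_word ks)" and ?s = "transpose i (Suc i)"
  let ?v = "w \<circ> ?s"
  note t = tight_word_snocD[OF snoc.prems(2)]
  have i: "i \<in> {1..<n}" and ks: "set (rev ks) \<subseteq> {1..<n}"
    using snoc.prems(2) by (auto simp: tight_word_def)
  have v: "?v permutes {1..n}"
    using i by (intro permutes_compose[OF _ snoc.prems(1)] permutes_swap_id) auto
  have v_iff: "?v = perm_of_word ks \<longleftrightarrow> w = perm_of_word ks \<circ> ?s"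
  proof -
    have "?v \<circ> ?s = w" "(perm_of_word ks \<circ> ?s) \<circ> ?s = perm_of_word ks"
      by (simp_all add: comp_assoc)
    then show ?thesis by metis
  qed
  have move: "?F (a @ rev ks) = ?F (b @ rev ks)" if "artin_eq n a b" for a b
    using trace_neg_artin_eq[OF artin_eq.append[OF that, of "[]" "rev ks"]] ks by simp
  show ?case
  proof (cases "w i < w (Suc i)")
    case True
    have "?F ((normal_word n w @ [i]) @ rev ks) = ?F (normal_word n ?v @ rev ks)"
      by (rule move[OF normal_word_ascent[OF snoc.prems(1) i True]])
    also have "\<dots> = (if ?v = perm_of_word ks then 1 else 0)"
      by (rule snoc.IH[OF v t(1)])
    finally show ?thesis
      unfolding perm_of_word_snoc v_iff by (simp only: rev_append rev.simps append_Nil append_Cons append_assoc)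
  next
    case False
    \<comment> \<open>By tightness \<open>perm_of_word ks\<close> ascends at \<open>i\<close> while
      \<open>w\<close> descends there. This kills the correction term below.\<close>
    then have ne: "w \<noteq> perm_of_word ks" using t(2) by auto
    note d = normal_word_descent[OF snoc.prems(1) i False]
    \<comment> \<open>One \<open>i\<close> comes from the descent of \<open>w\<close>, the other is
      the stripped letter; together they form the square to be expanded.\<close>
    have "artin_eq n ([] @ normal_word n w @ [i]) ([] @ (normal_word n ?v @ [i]) @ [i])"
      by (rule artin_eq.append[OF d]) (use i in auto)
    then have "?F ((normal_word n w @ [i]) @ rev ks) = ?F ((normal_word n ?v @ [i, i]) @ rev ks)"
      by (intro move) simp
    also have "\<dots> = ?F (normal_word n ?v @ rev ks) - [:0, 1:] * ?F ((normal_word n ?v @ [i]) @ rev ks)"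
      using trace_neg_square[OF assms(1) i normal_word_set[OF v] ks] by simp
    also have "?F ((normal_word n ?v @ [i]) @ rev ks) = ?F (normal_word n w @ rev ks)"
      by (rule move[OF artin_eq.sym[OF d]])
    also have "\<dots> = 0" using snoc.IH[OF snoc.prems(1) t(1)] ne by simp
    also have "?F (normal_word n ?v @ rev ks) = (if ?v = perm_of_word ks then 1 else 0)"
      by (rule snoc.IH[OF v t(1)])
    finally show ?thesis
      unfolding perm_of_word_snoc v_iff by (simp only: rev_append rev.simps append_Nil append_Cons append_assoc)
  qed
qed

end

section \<open>The extreme coefficient of the Homfly polynomial\<close>

text \<open>Moves the evaluation to power series, where the constant coefficient is a ring
  homomorphism.\<close>

lemma poly_fps_to_fls:
  "poly (map_poly (\<lambda>c. fls_const (to_fract c)) P) (fps_to_fls Y) =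
   fps_to_fls (poly (map_poly (\<lambda>c. fps_const (to_fract c)) P) Y)"
  by (induction P) (simp_all add: map_poly_pCons fls_times_fps_to_fls)

text \<open>Taking constant coefficients respects sums and products, so it can be applied to the
  coefficients and to the point of evaluation separately.\<close>

lemma fps_nth_0_poly:
  "fps_nth (poly (map_poly (\<lambda>c. fps_const (to_fract c)) P) Y) 0 = to_fract (poly P c)"
  if "fps_nth Y 0 = to_fract c"
  by (induction P) (simp_all add: map_poly_pCons that)

text \<open>Each of the \<open>n - 1\<close> factors splits off v^-1 and leaves z^-1 (1 - v^2). The
  wanted coefficient is thus the constant coefficient of a power series, and
  \<open>zvar ^ (n - 1)\<close> cancels the powers of z^-1.\<close>

lemma left_poly_eq_trace_at_z:
  assumes n: "1 \<le> n" and w: "w \<in> words n"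
  shows "left_poly Tr n (braid_eq n `` {w}) = to_fract (trace_at_z Tr n (of_word w))"
proof -
  define P where "P = Tr n (hecke_class n (of_word w))"
  define Q where "Q = (1 - fps_X ^ 2 :: int poly fract fps)"
  define Y where "Y = fps_const zvar * inverse Q"
  define R where "R = poly (map_poly (\<lambda>c. fps_const (to_fract c)) P) Y"
  have Q0: "fps_nth Q 0 = 1" by (simp add: Q_def)
  have z: "zvar \<noteq> 0" by (simp add: zvar_def)
  have Q_fls: "fps_to_fls Q = 1 - fls_X ^ 2"
    by (simp add: Q_def fps_to_fls_power)
  have Q_nz: "fps_to_fls Q \<noteq> 0" using Q0 by auto
  have "fps_to_fls (Y * Q) = fls_const zvar"
    using Q0 by (simp add: Y_def mult.assoc inverse_mult_eq_1)
  then have Y_fls: "fls_const zvar / (1 - fls_X ^ 2) = fps_to_fls Y"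
    using Q_nz by (simp add: fls_times_fps_to_fls divide_eq_eq flip: Q_fls)
  \<comment> \<open>\<open>Y\<close> is z / (1 - v^2) as a power series; its constant coefficient z
    is the source of the specialisation T = z.\<close>
  have R0: "fps_nth R 0 = to_fract (poly P [:0, 1:])"
    unfolding R_def by (rule fps_nth_0_poly) (simp add: Y_def Q0 zvar_def)
  have factor: "(inverse fls_X - fls_X) / fls_const zvar =
      fls_X_inv * (fls_const (inverse zvar) * fps_to_fls Q)"
  proof -
    have "(inverse x - x) / c = inverse x * (inverse c * (1 - x ^ 2))"
      if "x \<noteq> 0" for x c :: "int poly fract fls"
      using that by (simp add: field_simps power2_eq_square)
    from this[of fls_X "fls_const zvar"] show ?thesis
      by (simp only: Q_fls fls_inverse_X fls_inverse_const fls_X_nonzero simp_thms)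
  qed
  have "framed_homfly Tr n (braid_eq n `` {w}) =
      (fls_X_inv * (fls_const (inverse zvar) * fps_to_fls Q)) ^ (n - 1) * fps_to_fls R"
    unfolding framed_homfly_def hecke_of_braid_class[OF w] Y_fls poly_fps_to_fls factor P_def[symmetric] R_def ..
  also have "\<dots> = fls_X_inv ^ (n - 1) * fps_to_fls (fps_const (inverse zvar ^ (n - 1)) * Q ^ (n - 1) * R)"
    by (simp add: power_mult_distrib fls_times_fps_to_fls fps_to_fls_power fls_const_power mult.assoc)
  finally have "fls_nth (framed_homfly Tr n (braid_eq n `` {w})) (1 - int n) =
      fps_nth (fps_const (inverse zvar ^ (n - 1)) * Q ^ (n - 1) * R) 0"
    \<comment> \<open>As \<open>1 \<le> n\<close>, the subtraction \<open>n - 1\<close> is not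
      truncated, and \<open>fls_X_inv ^ (n - 1)\<close> moves coefficient 0 to index
      \<open>1 - int n\<close>.\<close>
    using n by (simp add: fls_X_inv_power_times_conv_shift of_nat_diff)
  also have "\<dots> = inverse zvar ^ (n - 1) * fps_nth R 0"
    by (simp add: mult.assoc fps_nth_power_0 Q0)
  finally show ?thesis
    using z by (simp add: left_poly_def R0 trace_at_z_def P_def power_inverse mult.assoc[symmetric])
qed

theorem proposition3:
  fixes Tr :: "nat \<Rightarrow> free_elem set \<Rightarrow> int poly poly"
    and n :: nat
    and \<pi> \<kappa> :: "nat \<Rightarrow> nat"
  assumes "ocneanu_trace Tr"
    and "1 \<le> n"
    and "\<pi> permutes {1..n}"
    and "\<kappa> permutes {1..n}"
  shows "left_inner Tr n (neg_perm_braid n \<pi>) (neg_perm_braid n \<kappa>) = (if \<pi> = \<kappa> then 1 else 0)"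
proof -
  define us where "us = (SOME ks. reduced_expression n \<pi> ks)"
  define vs where "vs = (SOME ks. reduced_expression n \<kappa> ks)"
  have us: "reduced_expression n \<pi> us"
    unfolding us_def by (rule someI_ex[OF reduced_expression_exists[OF assms(3)]])
  have vs: "reduced_expression n \<kappa> vs"
    unfolding vs_def by (rule someI_ex[OF reduced_expression_exists[OF assms(4)]])
  have perms: "perm_of_word us = \<pi>" "perm_of_word vs = \<kappa>"
    and sets: "set us \<subseteq> {1..<n}" "set vs \<subseteq> {1..<n}"
    using us vs unfolding reduced_expression_def by blast+
  \<comment> \<open>\<open>braid_star\<close> reverses the word but keeps the letters negative, so
    the right factor becomes \<open>rev vs\<close>.\<close>
  have "neg_perm_braid n \<pi> \<otimes>\<^bsub>braid_group n\<^esub> braid_star n (neg_perm_braid n \<kappa>) =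
      braid_eq n `` {Word (map Neg (us @ rev vs))}"
    using sets
    by (simp add: neg_perm_braid_def us_def[symmetric] vs_def[symmetric] braid_star_class
        braid_mult_class word_rev_def rev_map word_append)
  moreover have "left_poly Tr n (braid_eq n `` {Word (map Neg (us @ rev vs))}) =
      to_fract (trace_at_z Tr n (neg_word (us @ rev vs)))"
    unfolding neg_word_def using sets by (intro left_poly_eq_trace_at_z[OF assms(2)]) (simp del: map_append)
  ultimately have "left_inner Tr n (neg_perm_braid n \<pi>) (neg_perm_braid n \<kappa>) =
      to_fract (trace_at_z Tr n (neg_word (us @ rev vs)))"
    by (simp add: left_inner_def)
  also have "trace_at_z Tr n (neg_word (us @ rev vs)) =
      trace_at_z Tr n (neg_word (normal_word n \<pi> @ rev vs))"
  proof -
    \<comment> \<open>Only the left factor is brought to normal form; on the right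
      \<open>trace_neg_orthonormal\<close> accepts any tight word.\<close>
    have "artin_eq n us (normal_word n \<pi>)"
      using tight_word_normal[OF reduced_expression_tight[OF us assms(3)]] unfolding perms .
    then have "artin_eq n ([] @ us @ rev vs) ([] @ normal_word n \<pi> @ rev vs)"
      by (rule artin_eq.append) (use sets in auto)
    then show ?thesis unfolding append_Nil by (rule trace_neg_artin_eq[OF assms(1)])
  qed
  also have "\<dots> = (if \<pi> = \<kappa> then 1 else 0)"
    using trace_neg_orthonormal[OF assms(1-3) reduced_expression_tight[OF vs assms(4)]]
    unfolding perms .
  finally show ?thesis by simp
qed

end
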